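(* Let $(\alpha_1,\dots,\alpha_n)$ be any $n$-tuple of real numbers such that $\alpha_1$ is irrational but not a Liouville number. Then there exist constants $C>0$ and $T_0$ (independent of $T_1,\dots,T_n$ and $\gamma$) such that for any positive integers $T_1,\dots,T_n$ with $T_1>T_0$ and for any $\gamma\in\mathbb{R}$, $$\sum_{\substack{\mathbf q=(q_1,\dots,q_n)\in\mathbb{Z}^n\\ 1\le q_j\le T_j\ (1\le j\le n)}}\frac{1}{q_1\cdots q_n\,\|q_1\alpha_1+\dots+q_n\alpha_n-\gamma\|}\ \ge\ C\,\log T_1\prod_{i=1}^n\log T_i.$$
   Context: $\|x\|$ denotes the distance from $x\in\mathbb{R}$ to the nearest integer. A Liouville number is an $\alpha\in\mathbb{R}\setminus\mathbb{Q}$ such that $\liminf_{m\to\infty}m^w\|m\alpha\|=0$ for all $w>0$. A term with vanishing denominator is interpreted as $+\infty$. *)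

theory Defs
  imports Complex_Main "HOL-Library.FuncSet" "HOL-Library.Extended_Real"
begin

definition dist_nearest_int :: "real \<Rightarrow> real"  ("\<parallel>_\<parallel>\<^sub>\<int>") where
  "\<parallel>x\<parallel>\<^sub>\<int> = \<bar>x - of_int (round x)\<bar>"

definition liouville_number :: "real \<Rightarrow> bool" where
  "liouville_number \<alpha> \<longleftrightarrow> \<alpha> \<notin> \<rat> \<and>
     (\<forall>w>0. liminf (\<lambda>m. ereal (real m powr w * \<parallel>real m * \<alpha>\<parallel>\<^sub>\<int>)) = 0)"

(* The division is that of ereal, where 1 / 0 = \<infinity>; a term with vanishing
   denominator therefore contributes +\<infinity> to the sum. *)
definition reciprocal_sum :: "nat \<Rightarrow> (nat \<Rightarrow> real) \<Rightarrow> (nat \<Rightarrow> int) \<Rightarrow> real \<Rightarrow> ereal" where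
  "reciprocal_sum n \<alpha> T \<gamma> =
     (\<Sum>q \<in> (\<Pi>\<^sub>E j\<in>{1..n}. {1..T j}).
        1 / ereal ((\<Prod>j=1..n. real_of_int (q j)) *
                   \<parallel>(\<Sum>j=1..n. real_of_int (q j) * \<alpha> j) - \<gamma>\<parallel>\<^sub>\<int>))"

lemma one_div_zero_ereal: "1 / ereal 0 = \<infinity>"
  by (simp add: divide_ereal_def)

end

theory Submission
  imports Defs "HOL-Analysis.Kronecker_Approximation_Theorem" "HOL-Analysis.Harmonic_Numbers"
begin

text \<open>
  Everything comes from the first coordinate. Fixing \<open>q\<^sub>2, \<dots>, q\<^sub>n\<close> merely translates \<open>\<gamma>\<close>, so a bound
  \<open>c (log T)\<^sup>2\<close> for the one-dimensional sum of \<open>1 / (q \<parallel>q \<alpha> - \<gamma>\<parallel>)\<close> over \<open>q \<le> T\<close> which is uniform in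
  \<open>\<gamma>\<close> suffices: each other coordinate contributes a harmonic sum, that is, a factor of at least
  \<open>log T\<^sub>i\<close>.

  For the one-dimensional bound, Dirichlet's theorem provides for each \<open>M\<close> some \<open>p \<le> M\<close> with
  \<open>\<eta> = \<parallel>p \<alpha>\<parallel> < 1 / M\<close>. Modulo 1, a progression with common difference \<open>p \<alpha>\<close> moves around the circle
  in steps of length \<open>\<eta>\<close>. Within \<open>L\<close> steps, \<open>L\<close> being about \<open>1 / \<eta>\<close>, it comes \<open>\<eta>\<close>-close to an
  integer, and from there its distances to that integer are at most \<open>\<eta>, 2 \<eta>, 3 \<eta>, \<dots>\<close>. The reciprocal
  distances along \<open>2 L\<close> terms thus add up to at least \<open>(log L) / \<eta> \<ge> (log M) / \<eta>\<close>, whatever the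
  starting point (\<open>progression_sum_lower_bound\<close>). As \<open>L \<eta> \<le> 2\<close>, this means that
  \<open>1 / \<parallel>x + q \<alpha>\<parallel>\<close> is of order \<open>log M\<close> or more on average over any \<open>2 L p\<close> consecutive \<open>q\<close>, hence over
  all longer intervals (\<open>interval_sum_lower_bound\<close>).

  This is where \<open>\<alpha>\<close> must not be a Liouville number: then \<open>1 / \<eta>\<close> is at most a fixed power of
  \<open>p\<close>, so that \<open>2 L p\<close> is at most a fixed power of \<open>M\<close>. Hence \<open>M\<close> may be taken as a power of
  the length \<open>R\<close> of the interval, and the average over \<open>R\<close> consecutive \<open>q\<close> is of order
  \<open>log R\<close> (\<open>non_liouville_interval_sum\<close>). Splitting \<open>q \<le> T\<close> into about \<open>log T\<close> geometrically
  growing intervals, the \<open>k\<close>-th of them contributes a multiple of \<open>k\<close> to the sum weighted by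
  \<open>1 / q\<close>, and the sum of these contributions is of order \<open>(log T)\<^sup>2\<close>
  (\<open>weighted_sum_lower_bound\<close>).

  If some denominator vanishes, the sum is infinite and there is nothing to prove. All the estimates
  above can therefore be made in the reals, under the assumption that the distances involved are
  nonzero.
\<close>

section \<open>Distance to the nearest integer and non-Liouville numbers\<close>

lemma dist_nearest_int_nonneg: "\<parallel>x\<parallel>\<^sub>\<int> \<ge> 0"
  by (simp add: dist_nearest_int_def)

lemma dist_nearest_int_le: "\<parallel>x\<parallel>\<^sub>\<int> \<le> \<bar>x - of_int m\<bar>"
  unfolding dist_nearest_int_def by (rule round_diff_minimal)

lemma dist_nearest_int_le_half: "\<parallel>x\<parallel>\<^sub>\<int> \<le> 1 / 2"
  unfolding dist_nearest_int_def using of_int_round_abs_le[of x] by (simp add: abs_minus_commute)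

lemma dist_nearest_int_eq_0_imp_Ints: "\<parallel>x\<parallel>\<^sub>\<int> = 0 \<Longrightarrow> x \<in> \<int>"
  unfolding dist_nearest_int_def by (metis Ints_of_int abs_eq_0 eq_iff_diff_eq_0)

lemma dist_nearest_int_multiple_pos:
  assumes "\<alpha> \<notin> \<rat>" "m > 0"
  shows "\<parallel>real m * \<alpha>\<parallel>\<^sub>\<int> > 0"
proof (rule ccontr)
  assume "\<not> ?thesis"
  then have "real m * \<alpha> \<in> \<int>"
    using dist_nearest_int_nonneg[of "real m * \<alpha>"]
    by (intro dist_nearest_int_eq_0_imp_Ints) linarith
  then have "real m * \<alpha> / real m \<in> \<rat>"
    by (intro Rats_divide) (auto elim!: Ints_cases)
  then show False using assms by simp
qed

text \<open>
  A positive lower limit of \<open>m\<^sup>w \<parallel>m \<alpha>\<parallel>\<close> bounds \<open>1 / \<parallel>m \<alpha>\<parallel>\<close> for all large \<open>m\<close>. The remaining finitely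
  many values are absorbed into the constant; they are finite because \<open>\<alpha>\<close> is irrational.
\<close>
lemma non_liouville_reciprocal_bound:
  assumes irr: "\<alpha> \<notin> \<rat>" and nl: "\<not> liouville_number \<alpha>"
  obtains A :: real and d :: nat
  where "A > 0" "\<And>m. m > 0 \<Longrightarrow> 1 / \<parallel>real m * \<alpha>\<parallel>\<^sub>\<int> \<le> A * real m ^ d"
proof -
  let ?N = "\<lambda>m. \<parallel>real m * \<alpha>\<parallel>\<^sub>\<int>"
  obtain w where w: "w > 0" and ne: "liminf (\<lambda>m. ereal (real m powr w * ?N m)) \<noteq> 0"
    using assms unfolding liouville_number_def by blast
  have "liminf (\<lambda>m. ereal (real m powr w * ?N m)) \<ge> 0"
    by (intro Liminf_bounded always_eventually) (auto simp: dist_nearest_int_nonneg)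
  with ne have "0 < liminf (\<lambda>m. ereal (real m powr w * ?N m))" by simp
  then obtain y where y: "0 < y" "y < liminf (\<lambda>m. ereal (real m powr w * ?N m))"
    using dense by blast
  then have "y \<noteq> \<infinity>" by auto
  with y obtain c where c: "y = ereal c" "c > 0" by (cases y) auto
  from less_LiminfD[OF y(2)] obtain K where K: "\<And>m. m \<ge> K \<Longrightarrow> c < real m powr w * ?N m"
    unfolding c eventually_sequentially by auto
  define d where "d = nat \<lceil>w\<rceil>"
  have pw: "real m powr w \<le> real m ^ d" if "m > 0" for m
  proof -
    have "real m powr w \<le> real m powr real d"
      using that unfolding d_def by (intro powr_mono) (auto simp: real_nat_ceiling_ge)
    then show ?thesis using that by (simp add: powr_realpow)
  qed
  define A where "A = 1 / c + (\<Sum>m<K. 1 / ?N m)"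
  have sum0: "(\<Sum>m<K. 1 / ?N m) \<ge> 0"
    by (intro sum_nonneg) (simp add: dist_nearest_int_nonneg)
  show thesis
  proof
    show "A > 0" using c(2) sum0 unfolding A_def by (simp add: add_pos_nonneg)
    fix m :: nat assume m: "m > 0"
    have pos: "?N m > 0" using dist_nearest_int_multiple_pos irr m by blast
    have one: "1 \<le> real m ^ d" using m by simp
    show "1 / ?N m \<le> A * real m ^ d"
    proof (cases "m < K")
      case True
      then have "1 / ?N m \<le> (\<Sum>m<K. 1 / ?N m)"
        by (intro member_le_sum) (auto simp: dist_nearest_int_nonneg)
      also have "\<dots> \<le> A" using c(2) unfolding A_def by simp
      also have "A \<le> A * real m ^ d" using one \<open>A > 0\<close> by simp
      finally show ?thesis .
    next
      case False
      then have "c < real m powr w * ?N m" using K by simp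
      also have "\<dots> \<le> real m ^ d * ?N m" using pw[OF m] pos by (intro mult_right_mono) auto
      finally have "1 / ?N m \<le> (1 / c) * real m ^ d"
        using c(2) pos by (simp add: field_simps)
      also have "\<dots> \<le> A * real m ^ d" using sum0 unfolding A_def by (intro mult_right_mono) auto
      finally show ?thesis .
    qed
  qed
qed

section \<open>Reciprocal distances along progressions and intervals\<close>

text \<open>
  Write \<open>\<beta> = h \<plusminus> \<eta>\<close> with \<open>h\<close> an integer. Modulo 1 and up to a global sign, the progression
  increases by \<open>\<eta>\<close> in each step, so it must pass the next integer within \<open>1 / \<eta>\<close> steps; the
  index \<open>j\<^sub>0\<close> is the last one not beyond it. The integer then lies less than \<open>\<eta>\<close> ahead, and
  every further step adds at most \<open>\<eta>\<close> to the distance.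
\<close>
lemma progression_meets_integer:
  fixes x \<beta> :: real
  assumes "\<parallel>\<beta>\<parallel>\<^sub>\<int> > 0" "real L * \<parallel>\<beta>\<parallel>\<^sub>\<int> \<ge> 1"
  obtains j\<^sub>0 where "j\<^sub>0 < L"
    "\<And>i::nat. \<parallel>x + real (j\<^sub>0 + i) * \<beta>\<parallel>\<^sub>\<int> \<le> real (Suc i) * \<parallel>\<beta>\<parallel>\<^sub>\<int>"
proof -
  define \<eta> where "\<eta> = \<parallel>\<beta>\<parallel>\<^sub>\<int>"
  define h where "h = round \<beta>"
  obtain \<sigma> :: int where \<sigma>: "\<sigma> = 1 \<or> \<sigma> = -1" and \<beta>: "\<beta> = of_int h + of_int \<sigma> * \<eta>"
  proof (cases "\<beta> \<ge> of_int h")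
    case True
    then show ?thesis by (intro that[of 1]) (auto simp: \<eta>_def h_def dist_nearest_int_def)
  next
    case False
    then show ?thesis by (intro that[of "-1"]) (auto simp: \<eta>_def h_def dist_nearest_int_def)
  qed
  have \<eta>: "\<eta> > 0" "real L * \<eta> \<ge> 1" using assms by (auto simp: \<eta>_def)
  \<comment> \<open>After multiplication by \<open>\<sigma>\<close> the progression increases from \<open>y\<close>, and \<open>f\<close> is its initial gap to the
    next integer.\<close>
  define y where "y = of_int \<sigma> * x"
  define f where "f = of_int \<lceil>y\<rceil> - y"
  have f: "0 \<le> f" "f < 1" unfolding f_def by linarith+
  define j\<^sub>0 where "j\<^sub>0 = nat \<lfloor>f / \<eta>\<rfloor>"
  have fl: "0 \<le> \<lfloor>f / \<eta>\<rfloor>" using f \<eta> by simp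
  have j0: "real j\<^sub>0 \<le> f / \<eta>" "f / \<eta> < real j\<^sub>0 + 1"
    unfolding j\<^sub>0_def using fl by (simp_all add: of_nat_nat)
  then have j0': "real j\<^sub>0 * \<eta> \<le> f" "f < real j\<^sub>0 * \<eta> + \<eta>"
    using \<eta> by (simp_all add: field_simps)
  show thesis
  proof
    have "real j\<^sub>0 * \<eta> < real L * \<eta>" using j0'(1) f(2) \<eta>(2) by linarith
    then show "j\<^sub>0 < L" using \<eta>(1) by simp
    fix i :: nat
    define j where "j = j\<^sub>0 + i"
    have "\<parallel>x + real j * \<beta>\<parallel>\<^sub>\<int> \<le> \<bar>x + real j * \<beta> - of_int (int j * h + \<sigma> * \<lceil>y\<rceil>)\<bar>"
      by (rule dist_nearest_int_le)
    also have "x + real j * \<beta> - of_int (int j * h + \<sigma> * \<lceil>y\<rceil>) = of_int \<sigma> * (real j * \<eta> - f)"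
      using \<sigma> by (auto simp: \<beta> f_def y_def algebra_simps)
    also have "\<bar>of_int \<sigma> * (real j * \<eta> - f)\<bar> = \<bar>real j * \<eta> - f\<bar>"
      using \<sigma> by (auto simp: abs_mult)
    also have "\<dots> \<le> real (Suc i) * \<eta>"
    proof -
      have "0 \<le> real i * \<eta>" using \<eta> by simp
      moreover have "real j * \<eta> = real j\<^sub>0 * \<eta> + real i * \<eta>"
        and "real (Suc i) * \<eta> = real i * \<eta> + \<eta>"
        by (simp_all add: j_def algebra_simps)
      ultimately show ?thesis using j0' by linarith
    qed
    finally show "\<parallel>x + real (j\<^sub>0 + i) * \<beta>\<parallel>\<^sub>\<int> \<le> real (Suc i) * \<parallel>\<beta>\<parallel>\<^sub>\<int>"
      by (simp add: j_def \<eta>_def)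
  qed
qed

lemma ln_le_harmonic_sum: "ln (real L + 1) \<le> (\<Sum>i<L. 1 / real (Suc i))"
proof -
  have "(\<Sum>i<L. 1 / real (Suc i)) = harm L"
    unfolding harm_def by (simp add: inverse_eq_divide sum.atLeast1_atMost_eq)
  then show ?thesis using ln_le_harm[of L] by simp
qed

text \<open>
  Twice \<open>L\<close> terms are summed so that, wherever in the first half the progression meets an integer,
  the \<open>L\<close> terms from there on are all included. Vanishing distances have to
  be excluded because \<open>1 / 0 = 0\<close> in the reals.
\<close>
lemma progression_sum_lower_bound:
  fixes x \<beta> :: real
  assumes \<eta>: "\<parallel>\<beta>\<parallel>\<^sub>\<int> > 0" "real L * \<parallel>\<beta>\<parallel>\<^sub>\<int> \<ge> 1"
    and nz: "\<And>j. j < 2 * L \<Longrightarrow> \<parallel>x + real j * \<beta>\<parallel>\<^sub>\<int> \<noteq> 0"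
  shows "ln (real L) / \<parallel>\<beta>\<parallel>\<^sub>\<int> \<le> (\<Sum>j<2*L. 1 / \<parallel>x + real j * \<beta>\<parallel>\<^sub>\<int>)"
proof -
  obtain j\<^sub>0 where j0: "j\<^sub>0 < L"
    "\<And>i::nat. \<parallel>x + real (j\<^sub>0 + i) * \<beta>\<parallel>\<^sub>\<int> \<le> real (Suc i) * \<parallel>\<beta>\<parallel>\<^sub>\<int>"
    using progression_meets_integer[OF \<eta>] by metis
  have L: "L > 0" using j0(1) by simp
  have "ln (real L) \<le> ln (real L + 1)" using L by simp
  also have "\<dots> \<le> (\<Sum>i<L. 1 / real (Suc i))" by (rule ln_le_harmonic_sum)
  finally have "ln (real L) / \<parallel>\<beta>\<parallel>\<^sub>\<int> \<le> (\<Sum>i<L. 1 / real (Suc i)) / \<parallel>\<beta>\<parallel>\<^sub>\<int>"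
    using \<eta>(1) by (intro divide_right_mono) auto
  also have "\<dots> = (\<Sum>i<L. 1 / (real (Suc i) * \<parallel>\<beta>\<parallel>\<^sub>\<int>))"
    by (simp add: sum_divide_distrib)
  also have "\<dots> \<le> (\<Sum>i<L. 1 / \<parallel>x + real (j\<^sub>0 + i) * \<beta>\<parallel>\<^sub>\<int>)"
  proof (intro sum_mono)
    fix i assume "i \<in> {..<L}"
    then have "j\<^sub>0 + i < 2 * L" using j0(1) by simp
    then have "\<parallel>x + real (j\<^sub>0 + i) * \<beta>\<parallel>\<^sub>\<int> > 0"
      using nz dist_nearest_int_nonneg by (metis less_eq_real_def)
    then show "1 / (real (Suc i) * \<parallel>\<beta>\<parallel>\<^sub>\<int>) \<le> 1 / \<parallel>x + real (j\<^sub>0 + i) * \<beta>\<parallel>\<^sub>\<int>"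
      using j0(2)[of i] by (intro divide_left_mono) (auto intro!: mult_pos_pos \<eta>(1))
  qed
  also have "\<dots> = (\<Sum>j\<in>(+) j\<^sub>0 ` {..<L}. 1 / \<parallel>x + real j * \<beta>\<parallel>\<^sub>\<int>)"
    by (subst sum.reindex) auto
  also have "\<dots> \<le> (\<Sum>j<2*L. 1 / \<parallel>x + real j * \<beta>\<parallel>\<^sub>\<int>)"
    using j0(1) by (intro sum_mono2) (auto simp: dist_nearest_int_nonneg)
  finally show ?thesis .
qed

lemma sum_block_shift: "sum f {a..<a + k} = (\<Sum>r<k. f (a + r :: nat))"
  using sum.shift_bounds_nat_ivl[of f 0 a k] by (simp add: add.commute lessThan_atLeast0)

text \<open>Among \<open>2 L p\<close> consecutive integers, each residue class modulo \<open>p\<close> is a progression as above.\<close>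
lemma block_sum_lower_bound:
  fixes x \<alpha> :: real
  assumes \<eta>: "\<parallel>real p * \<alpha>\<parallel>\<^sub>\<int> > 0" "real L * \<parallel>real p * \<alpha>\<parallel>\<^sub>\<int> \<ge> 1"
    and nz: "\<And>q. q < 2 * L * p \<Longrightarrow> \<parallel>x + real q * \<alpha>\<parallel>\<^sub>\<int> \<noteq> 0"
  shows "real p * ln (real L) / \<parallel>real p * \<alpha>\<parallel>\<^sub>\<int> \<le> (\<Sum>q<2*L*p. 1 / \<parallel>x + real q * \<alpha>\<parallel>\<^sub>\<int>)"
proof -
  let ?f = "\<lambda>q::nat. 1 / \<parallel>x + real q * \<alpha>\<parallel>\<^sub>\<int>"
  have eq: "x + real (j * p + r) * \<alpha> = (x + real r * \<alpha>) + real j * (real p * \<alpha>)" for j r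
    by (simp add: algebra_simps)
  have "real p * ln (real L) / \<parallel>real p * \<alpha>\<parallel>\<^sub>\<int> = (\<Sum>r<p. ln (real L) / \<parallel>real p * \<alpha>\<parallel>\<^sub>\<int>)"
    by simp
  also have "\<dots> \<le> (\<Sum>r<p. \<Sum>j<2*L. 1 / \<parallel>(x + real r * \<alpha>) + real j * (real p * \<alpha>)\<parallel>\<^sub>\<int>)"
  proof (intro sum_mono progression_sum_lower_bound \<eta>)
    fix r j assume r: "r \<in> {..<p}" and j: "j < 2 * L"
    have "j * p + r < Suc j * p" using r by simp
    also have "\<dots> \<le> 2 * L * p" using j by (intro mult_right_mono) auto
    finally show "\<parallel>(x + real r * \<alpha>) + real j * (real p * \<alpha>)\<parallel>\<^sub>\<int> \<noteq> 0"
      using nz unfolding eq[symmetric] by blast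
  qed
  also have "\<dots> = (\<Sum>r<p. \<Sum>j<2*L. ?f (j * p + r))" by (simp only: eq)
  also have "\<dots> = (\<Sum>j<2*L. \<Sum>r<p. ?f (j * p + r))" by (rule sum.swap)
  also have "\<dots> = (\<Sum>j<2*L. sum ?f {j * p..<j * p + p})" by (simp only: sum_block_shift)
  also have "\<dots> = (\<Sum>q<2*L*p. ?f q)" by (rule sum.nat_group)
  finally show ?thesis .
qed

text \<open>
  A block of length \<open>2 L p\<close> contributes \<open>p (log L) / \<eta>\<close>, which is \<open>(log L) / (2 L \<eta>) \<ge> (log L) / 4\<close> per
  element. Rounding the interval down to a whole number of blocks loses at most another
  factor 2.
\<close>
lemma interval_sum_lower_bound:
  fixes x \<alpha> :: real
  assumes p: "p > 0" and \<eta>: "\<parallel>real p * \<alpha>\<parallel>\<^sub>\<int> > 0" and L: "L = nat \<lceil>1 / \<parallel>real p * \<alpha>\<parallel>\<^sub>\<int>\<rceil>"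
    and R: "2 * L * p \<le> R"
    and nz: "\<And>q. q < R \<Longrightarrow> \<parallel>x + real q * \<alpha>\<parallel>\<^sub>\<int> \<noteq> 0"
  shows "real R * ln (real L) / 8 \<le> (\<Sum>q<R. 1 / \<parallel>x + real q * \<alpha>\<parallel>\<^sub>\<int>)"
proof -
  let ?f = "\<lambda>q::nat. 1 / \<parallel>x + real q * \<alpha>\<parallel>\<^sub>\<int>"
  define \<eta> where "\<eta> = \<parallel>real p * \<alpha>\<parallel>\<^sub>\<int>"
  define N where "N = 2 * L * p"
  define k where "k = R div N"
  have \<eta>pos: "\<eta> > 0" and \<eta>1: "\<eta> \<le> 1"
    using \<eta> dist_nearest_int_le_half[of "real p * \<alpha>"] by (auto simp: \<eta>_def)
  have "1 / \<eta> > 0" using \<eta>pos by simp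
  then have Lr: "1 / \<eta> \<le> real L" "real L \<le> 1 / \<eta> + 1" and "L > 0"
    unfolding L \<eta>_def[symmetric] by linarith+
  then have L\<eta>: "1 \<le> real L * \<eta>" "real L * \<eta> \<le> 2"
    using \<eta>pos \<eta>1 by (simp_all add: field_simps)
  have N: "N > 0" using p \<open>L > 0\<close> by (simp add: N_def)
  have lnL: "ln (real L) \<ge> 0" using \<open>L > 0\<close> by simp
  have kN: "k * N \<le> R" unfolding k_def by simp
  have "k \<ge> 1" using R N by (simp add: k_def N_def[symmetric] div_greater_zero_iff Suc_leI)
  have "R < (k + 1) * N" unfolding k_def using N dividend_less_div_times[of N R] by simp
  also have "\<dots> \<le> (2 * k) * N" using \<open>k \<ge> 1\<close> by (intro mult_right_mono) auto
  finally have "real R \<le> real (2 * k * N)" by linarith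
  then have R4: "real R \<le> 4 * real k * real L * real p" by (simp add: N_def)
  have "real R * ln (real L) / 8 \<le> (4 * real k * real L * real p) * ln (real L) / 8"
    using R4 lnL by (intro divide_right_mono mult_right_mono) auto
  also have "\<dots> = (real k * real p * ln (real L)) * (real L / 2)" by simp
  also have "\<dots> \<le> (real k * real p * ln (real L)) * (1 / \<eta>)"
    using L\<eta>(2) \<eta>pos lnL by (intro mult_left_mono) (auto simp: field_simps)
  also have "\<dots> = (\<Sum>m<k. real p * ln (real L) / \<eta>)" by simp
  also have "\<dots> \<le> (\<Sum>m<k. \<Sum>q<N. 1 / \<parallel>(x + real (m * N) * \<alpha>) + real q * \<alpha>\<parallel>\<^sub>\<int>)"
    unfolding \<eta>_def N_def
  proof (intro sum_mono block_sum_lower_bound)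
    show "\<parallel>real p * \<alpha>\<parallel>\<^sub>\<int> > 0" by fact
    show "real L * \<parallel>real p * \<alpha>\<parallel>\<^sub>\<int> \<ge> 1" using L\<eta>(1) by (simp add: \<eta>_def)
    fix m q assume m: "m \<in> {..<k}" and q: "q < 2 * L * p"
    have "m * N + q < Suc m * N" using q by (simp add: N_def)
    also have "\<dots> \<le> k * N" using m by (intro mult_right_mono) auto
    finally have "m * N + q < R" using kN by simp
    from nz[OF this] show "\<parallel>x + real (m * (2 * L * p)) * \<alpha> + real q * \<alpha>\<parallel>\<^sub>\<int> \<noteq> 0"
      by (simp add: N_def algebra_simps)
  qed
  also have "\<dots> = (\<Sum>m<k. sum ?f {m * N..<m * N + N})"
    unfolding sum_block_shift by (simp add: algebra_simps)
  also have "\<dots> = (\<Sum>q<k*N. ?f q)" by (rule sum.nat_group)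
  also have "\<dots> \<le> (\<Sum>q<R. ?f q)"
    using kN by (intro sum_mono2) (auto simp: dist_nearest_int_nonneg)
  finally show ?thesis .
qed

section \<open>The one-dimensional bound\<close>

text \<open>
  Dirichlet's theorem alone makes the interval bound available only for lengths above some \<open>2 L p\<close>
  over which there is no control. A polynomial bound on \<open>1 / \<parallel>p \<alpha>\<parallel>\<close> turns this threshold into a
  polynomial in \<open>M\<close>, uniformly in the offset \<open>x\<close>.
\<close>
lemma non_liouville_interval_sum:
  assumes irr: "\<alpha> \<notin> \<rat>" and nl: "\<not> liouville_number \<alpha>"
  obtains B d :: nat where "B > 0" "d > 0"
    "\<And>M R x. \<lbrakk>M > 0; B * M ^ d \<le> R; \<And>q. q < R \<Longrightarrow> \<parallel>x + real q * \<alpha>\<parallel>\<^sub>\<int> \<noteq> 0\<rbrakk>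
       \<Longrightarrow> real R * ln (real M) / 8 \<le> (\<Sum>q<R. 1 / \<parallel>x + real q * \<alpha>\<parallel>\<^sub>\<int>)"
proof -
  obtain A d where A: "A > 0" and Ad: "\<And>m. m > 0 \<Longrightarrow> 1 / \<parallel>real m * \<alpha>\<parallel>\<^sub>\<int> \<le> A * real m ^ d"
    using non_liouville_reciprocal_bound[OF assms] by blast
  define B where "B = nat \<lceil>4 * A\<rceil>"
  have B: "real B \<ge> 4 * A" unfolding B_def by (rule real_nat_ceiling_ge)
  with A have "B > 0" by (cases B) auto
  show thesis
  proof (rule that[of B "Suc d"])
    fix M R :: nat and x :: real
    assume M: "M > 0" and R: "B * M ^ Suc d \<le> R"
      and nz: "\<And>q. q < R \<Longrightarrow> \<parallel>x + real q * \<alpha>\<parallel>\<^sub>\<int> \<noteq> 0"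
    obtain h k where hk: "0 < k" "k \<le> int M" "\<bar>of_int k * \<alpha> - of_int h\<bar> < 1 / real M"
      using Dirichlet_approx[OF M, of \<alpha>] by metis
    define p where "p = nat k"
    define L where "L = nat \<lceil>1 / \<parallel>real p * \<alpha>\<parallel>\<^sub>\<int>\<rceil>"
    have p: "p > 0" "p \<le> M" using hk by (auto simp: p_def)
    have "\<parallel>real p * \<alpha>\<parallel>\<^sub>\<int> \<le> \<bar>real p * \<alpha> - of_int h\<bar>" by (rule dist_nearest_int_le)
    also have "\<dots> < 1 / real M" using hk by (simp add: p_def)
    finally have small: "\<parallel>real p * \<alpha>\<parallel>\<^sub>\<int> < 1 / real M" .
    have pos: "\<parallel>real p * \<alpha>\<parallel>\<^sub>\<int> > 0" using dist_nearest_int_multiple_pos irr p by blast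
    have "real M \<le> 1 / \<parallel>real p * \<alpha>\<parallel>\<^sub>\<int>" using small pos M by (simp add: field_simps)
    also have "\<dots> \<le> real L" unfolding L_def by (rule real_nat_ceiling_ge)
    finally have M_le_L: "real M \<le> real L" .
    have one: "1 \<le> 1 / \<parallel>real p * \<alpha>\<parallel>\<^sub>\<int>"
      using pos dist_nearest_int_le_half[of "real p * \<alpha>"] by (simp add: field_simps)
    then have "real L \<le> 2 * (1 / \<parallel>real p * \<alpha>\<parallel>\<^sub>\<int>)" unfolding L_def by linarith
    also have "\<dots> \<le> 2 * (A * real p ^ d)" using Ad[OF p(1)] by (intro mult_left_mono) auto
    also have "\<dots> \<le> 2 * (A * real M ^ d)"
      using A p by (intro mult_left_mono power_mono) auto
    finally have L2: "real L \<le> 2 * (A * real M ^ d)" .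
    have "real (2 * L * p) \<le> 2 * (2 * (A * real M ^ d)) * real M"
      using L2 p(2) A by (simp only: of_nat_mult of_nat_numeral) (intro mult_mono, auto)
    also have "\<dots> = 4 * A * real M ^ Suc d" by simp
    also have "\<dots> \<le> real B * real M ^ Suc d" using B by (intro mult_right_mono) auto
    also have "\<dots> = real (B * M ^ Suc d)" by simp
    also have "\<dots> \<le> real R" using R by (simp only: of_nat_le_iff)
    finally have LR: "2 * L * p \<le> R" by (simp only: of_nat_le_iff)
    have "real R * ln (real M) / 8 \<le> real R * ln (real L) / 8"
      using M_le_L M by (intro divide_right_mono mult_left_mono ln_mono) auto
    also have "\<dots> \<le> (\<Sum>q<R. 1 / \<parallel>x + real q * \<alpha>\<parallel>\<^sub>\<int>)"
      by (rule interval_sum_lower_bound[OF p(1) pos L_def LR nz])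
    finally show "real R * ln (real M) / 8 \<le> (\<Sum>q<R. 1 / \<parallel>x + real q * \<alpha>\<parallel>\<^sub>\<int>)" .
  qed (use \<open>B > 0\<close> in auto)
qed

text \<open>
  The intervals \<open>(Q\<^sub>k, Q\<^sub>k\<^sub>+\<^sub>1]\<close> with \<open>Q\<^sub>k = B 2\<^sup>d\<^sup>k\<close> are long enough for the previous lemma
  with \<open>M = 2\<^sup>k\<close>.
\<close>
lemma weighted_sum_lower_bound:
  assumes irr: "\<alpha> \<notin> \<rat>" and nl: "\<not> liouville_number \<alpha>"
  obtains c :: real and T\<^sub>0 :: nat where "c > 0"
    "\<And>T \<gamma>. \<lbrakk>T \<ge> T\<^sub>0; \<And>q. 0 < q \<Longrightarrow> q \<le> T \<Longrightarrow> \<parallel>real q * \<alpha> - \<gamma>\<parallel>\<^sub>\<int> \<noteq> 0\<rbrakk>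
       \<Longrightarrow> c * (ln (real T))\<^sup>2 \<le> (\<Sum>q=1..T. 1 / (real q * \<parallel>real q * \<alpha> - \<gamma>\<parallel>\<^sub>\<int>))"
proof -
  obtain B d :: nat where B: "B > 0" and d: "d > 0" and
    key: "\<And>M R x. \<lbrakk>M > 0; B * M ^ d \<le> R; \<And>q. q < R \<Longrightarrow> \<parallel>x + real q * \<alpha>\<parallel>\<^sub>\<int> \<noteq> 0\<rbrakk>
       \<Longrightarrow> real R * ln (real M) / 8 \<le> (\<Sum>q<R. 1 / \<parallel>x + real q * \<alpha>\<parallel>\<^sub>\<int>)"
    using non_liouville_interval_sum[OF assms] by blast
  define D where "D = (2::nat) ^ d"
  have D: "D \<ge> 2" using d self_le_power[of "2::nat" d] by (simp add: D_def)
  define Q where "Q m = B * D ^ m" for m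
  have Q2: "2 * Q m \<le> Q (Suc m)" for m using D by (simp add: Q_def)
  have Qpos: "Q m > 0" for m using B D by (simp add: Q_def)
  have dyadic: "ln 2 / 32 * (real m * (real m - 1))
      \<le> (\<Sum>q=1..Q m. 1 / (real q * \<parallel>real q * \<alpha> - \<gamma>\<parallel>\<^sub>\<int>))"
    if "\<And>q. 0 < q \<Longrightarrow> q \<le> Q m \<Longrightarrow> \<parallel>real q * \<alpha> - \<gamma>\<parallel>\<^sub>\<int> \<noteq> 0" for m \<gamma>
    using that
  proof (induction m)
    case 0
    then show ?case by (simp add: sum_nonneg dist_nearest_int_nonneg)
  next
    case (Suc m)
    let ?f = "\<lambda>q::nat. 1 / (real q * \<parallel>real q * \<alpha> - \<gamma>\<parallel>\<^sub>\<int>)"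
    define R where "R = Q (Suc m) - Q m"
    define x where "x = real (Suc (Q m)) * \<alpha> - \<gamma>"
    have QR: "Q (Suc m) = Q m + R" and RQ: "Q m \<le> R" using Q2[of m] by (auto simp: R_def)
    have xq: "x + real q * \<alpha> = real (Suc (Q m) + q) * \<alpha> - \<gamma>" for q
      by (simp add: x_def algebra_simps)
    have "real R * ln (real (2 ^ m)) / 8 \<le> (\<Sum>q<R. 1 / \<parallel>x + real q * \<alpha>\<parallel>\<^sub>\<int>)"
    proof (rule key)
      show "B * (2 ^ m) ^ d \<le> R"
        using RQ by (simp add: Q_def D_def power_mult[symmetric] mult.commute)
      show "\<parallel>x + real q * \<alpha>\<parallel>\<^sub>\<int> \<noteq> 0" if "q < R" for q
        unfolding xq using that by (intro Suc.prems) (auto simp: QR)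
    qed simp
    then have *: "real R * (real m * ln 2) / 8 \<le> (\<Sum>q<R. 1 / \<parallel>x + real q * \<alpha>\<parallel>\<^sub>\<int>)"
      by (simp add: ln_realpow)
    \<comment> \<open>The weight \<open>1 / q\<close> is at least \<open>1 / Q (Suc m)\<close> on the new interval, which makes up at least
      half of \<open>{1..Q (Suc m)}\<close>.\<close>
    have "real m * ln 2 / 16 \<le> (real R / real (Q (Suc m))) * (real m * ln 2 / 8)"
    proof -
      have "1 / 2 \<le> real R / real (Q (Suc m))"
        using RQ Qpos[of m] by (simp add: QR field_simps)
      then have "(1 / 2) * (real m * ln 2 / 8) \<le> (real R / real (Q (Suc m))) * (real m * ln 2 / 8)"
        by (intro mult_right_mono) auto
      then show ?thesis by simp
    qed
    also have "\<dots> = (real R * (real m * ln 2) / 8) / real (Q (Suc m))" by simp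
    also have "\<dots> \<le> (\<Sum>q<R. 1 / \<parallel>x + real q * \<alpha>\<parallel>\<^sub>\<int>) / real (Q (Suc m))"
      using * by (intro divide_right_mono) auto
    also have "\<dots> = (\<Sum>q<R. 1 / (real (Q (Suc m)) * \<parallel>x + real q * \<alpha>\<parallel>\<^sub>\<int>))"
      by (simp add: sum_divide_distrib mult.commute)
    also have "\<dots> \<le> (\<Sum>q<R. ?f (Suc (Q m) + q))"
    proof (intro sum_mono)
      fix q assume q: "q \<in> {..<R}"
      then have "\<parallel>x + real q * \<alpha>\<parallel>\<^sub>\<int> \<noteq> 0"
        unfolding xq by (intro Suc.prems) (auto simp: QR)
      then have pos: "\<parallel>x + real q * \<alpha>\<parallel>\<^sub>\<int> > 0"
        using dist_nearest_int_nonneg by (metis less_eq_real_def)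
      have "real (Suc (Q m) + q) \<le> real (Q (Suc m))" using q by (simp only: QR of_nat_le_iff) auto
      then have "1 / (real (Q (Suc m)) * \<parallel>x + real q * \<alpha>\<parallel>\<^sub>\<int>)
          \<le> 1 / (real (Suc (Q m) + q) * \<parallel>x + real q * \<alpha>\<parallel>\<^sub>\<int>)"
        using pos Qpos[of "Suc m"] by (intro divide_left_mono mult_right_mono mult_pos_pos) auto
      then show "1 / (real (Q (Suc m)) * \<parallel>x + real q * \<alpha>\<parallel>\<^sub>\<int>) \<le> ?f (Suc (Q m) + q)"
        by (simp only: xq)
    qed
    also have "\<dots> = sum ?f {Suc (Q m)..<Suc (Q m) + R}" by (simp only: sum_block_shift)
    also have "{Suc (Q m)..<Suc (Q m) + R} = {Suc (Q m)..Q (Suc m)}" by (auto simp: QR)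
    finally have new: "real m * ln 2 / 16 \<le> sum ?f {Suc (Q m)..Q (Suc m)}" .
    have old: "ln 2 / 32 * (real m * (real m - 1)) \<le> sum ?f {1..Q m}"
      using Q2[of m] by (intro Suc.IH Suc.prems) auto
    have "{1..Q (Suc m)} = {1..Q m} \<union> {Suc (Q m)..Q (Suc m)}" by (auto simp: QR)
    then have "sum ?f {1..Q (Suc m)} = sum ?f {1..Q m} + sum ?f {Suc (Q m)..Q (Suc m)}"
      by (simp only:) (rule sum.union_disjoint; auto)
    moreover have "ln 2 / 32 * (real (Suc m) * (real (Suc m) - 1))
        = ln 2 / 32 * (real m * (real m - 1)) + real m * ln 2 / 16"
      by (simp add: field_simps)
    ultimately show ?case using old new by linarith
  qed
  \<comment> \<open>If \<open>m \<ge> 1\<close> and \<open>T < Q (Suc m)\<close>, then \<open>ln T \<le> m * W\<close>.\<close>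
  define W where "W = ln (real B) + 2 * ln (real D)"
  have W: "W > 0" unfolding W_def using B D by (intro add_nonneg_pos) auto
  show thesis
  \<comment> \<open>Starting from \<open>Q 2\<close> guarantees \<open>m \<ge> 2\<close>, so that \<open>m - 1 \<ge> m / 2\<close>.\<close>
  proof (rule that[of "ln 2 / (64 * W\<^sup>2)" "Q 2"])
    show "ln 2 / (64 * W\<^sup>2) > (0::real)" using W by simp
    fix T :: nat and \<gamma> :: real
    assume T: "T \<ge> Q 2" and nz: "\<And>q. 0 < q \<Longrightarrow> q \<le> T \<Longrightarrow> \<parallel>real q * \<alpha> - \<gamma>\<parallel>\<^sub>\<int> \<noteq> 0"
    let ?f = "\<lambda>q::nat. 1 / (real q * \<parallel>real q * \<alpha> - \<gamma>\<parallel>\<^sub>\<int>)"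
    have bound: "m \<le> T" if "Q m \<le> T" for m
    proof -
      have "m < D ^ m" using D by (intro less_exp[THEN less_le_trans] power_mono) auto
      also have "\<dots> \<le> Q m" using B by (simp add: Q_def)
      finally show ?thesis using that by simp
    qed
    define m where "m = (GREATEST m. Q m \<le> T)"
    have m: "Q m \<le> T" unfolding m_def using T bound by (rule GreatestI_nat)
    have m2: "m \<ge> 2" unfolding m_def using T bound by (rule Greatest_le_nat)
    have "\<not> Q (Suc m) \<le> T"
    proof
      assume "Q (Suc m) \<le> T"
      then have "Suc m \<le> m" unfolding m_def using bound by (rule Greatest_le_nat)
      then show False by simp
    qed
    then have "real T \<le> real (Q (Suc m))" by simp
    moreover have T0: "T > 0" using T Qpos[of 2] by simp
    ultimately have "ln (real T) \<le> ln (real (Q (Suc m)))" by simp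
    also have "\<dots> = ln (real B) + (real m + 1) * ln (real D)"
      using B D by (simp add: Q_def ln_mult ln_realpow algebra_simps)
    also have "\<dots> \<le> real m * ln (real B) + (2 * real m) * ln (real D)"
    proof (intro add_mono mult_right_mono)
      have "0 \<le> ln (real B)" using B by simp
      then show "ln (real B) \<le> real m * ln (real B)"
        using m2 mult_right_mono[of 1 "real m" "ln (real B)"] by simp
    qed (use m2 D in auto)
    also have "\<dots> = real m * W" by (simp add: W_def algebra_simps)
    finally have lnT: "ln (real T) \<le> real m * W" .
    have "(ln (real T))\<^sup>2 \<le> (real m * W)\<^sup>2" using lnT T0 by (intro power_mono) auto
    then have "ln 2 / (64 * W\<^sup>2) * (ln (real T))\<^sup>2 \<le> ln 2 / (64 * W\<^sup>2) * (real m * W)\<^sup>2"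
      using W by (intro mult_left_mono) auto
    also have "\<dots> = ln 2 / 32 * (real m * (real m / 2))"
      using W by (simp add: power_mult_distrib power2_eq_square)
    also have "\<dots> \<le> ln 2 / 32 * (real m * (real m - 1))"
      using m2 by (intro mult_left_mono) auto
    also have "\<dots> \<le> sum ?f {1..Q m}" using nz m by (intro dyadic) auto
    also have "\<dots> \<le> sum ?f {1..T}"
      using m by (intro sum_mono2) (auto simp: dist_nearest_int_nonneg)
    finally show "ln 2 / (64 * W\<^sup>2) * (ln (real T))\<^sup>2 \<le> sum ?f {1..T}" .
  qed
qed

section \<open>Several variables\<close>

lemma sum_int_interval_eq_nat:
  assumes "T \<ge> 0"
  shows "(\<Sum>q\<in>{1..T}. f q) = (\<Sum>k=1..nat T. f (int k))"
  using assms
  by (intro sum.reindex_bij_witness[of _ int nat]) auto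

lemma ln_le_sum_reciprocals_int:
  assumes "T > 0"
  shows "ln (real_of_int T) \<le> (\<Sum>q\<in>{1..T}. 1 / real_of_int q)"
proof -
  have "ln (real_of_int T) \<le> ln (real (nat T) + 1)" using assms by simp
  also have "\<dots> \<le> (\<Sum>i<nat T. 1 / real (Suc i))" by (rule ln_le_harmonic_sum)
  also have "\<dots> = (\<Sum>q\<in>{1..T}. 1 / real_of_int q)"
    using assms by (simp add: sum_int_interval_eq_nat sum.atLeast1_atMost_eq)
  finally show ?thesis .
qed

lemma reciprocal_sum_finite_eq:
  assumes "\<And>q. q \<in> (\<Pi>\<^sub>E j\<in>{1..n}. {1..T j}) \<Longrightarrow> \<parallel>(\<Sum>j=1..n. real_of_int (q j) * \<alpha> j) - \<gamma>\<parallel>\<^sub>\<int> \<noteq> 0"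
  shows "reciprocal_sum n \<alpha> T \<gamma> = ereal (\<Sum>q \<in> (\<Pi>\<^sub>E j\<in>{1..n}. {1..T j}).
        1 / ((\<Prod>j=1..n. real_of_int (q j)) * \<parallel>(\<Sum>j=1..n. real_of_int (q j) * \<alpha> j) - \<gamma>\<parallel>\<^sub>\<int>))"
proof -
  have *: "1 / ereal ((\<Prod>j=1..n. real_of_int (q j)) * \<parallel>(\<Sum>j=1..n. real_of_int (q j) * \<alpha> j) - \<gamma>\<parallel>\<^sub>\<int>)
     = ereal (1 / ((\<Prod>j=1..n. real_of_int (q j)) * \<parallel>(\<Sum>j=1..n. real_of_int (q j) * \<alpha> j) - \<gamma>\<parallel>\<^sub>\<int>))"
    if q: "q \<in> (\<Pi>\<^sub>E j\<in>{1..n}. {1..T j})" for q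
  proof -
    have "(\<Prod>j=1..n. real_of_int (q j)) \<noteq> 0"
      using q by (fastforce simp: PiE_iff)
    with assms[OF q] show ?thesis by (simp add: one_ereal_def)
  qed
  show ?thesis
    unfolding reciprocal_sum_def by (subst sum_ereal[symmetric], rule sum.cong[OF refl *])
qed

lemma reciprocal_sum_infinite:
  assumes q: "q \<in> (\<Pi>\<^sub>E j\<in>{1..n}. {1..T j})"
    and zero: "\<parallel>(\<Sum>j=1..n. real_of_int (q j) * \<alpha> j) - \<gamma>\<parallel>\<^sub>\<int> = 0"
  shows "reciprocal_sum n \<alpha> T \<gamma> = \<infinity>"
proof -
  let ?P = "\<Pi>\<^sub>E j\<in>{1..n}. {1..T j}"
  let ?t = "\<lambda>q. 1 / ereal ((\<Prod>j=1..n. real_of_int (q j)) *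
                   \<parallel>(\<Sum>j=1..n. real_of_int (q j) * \<alpha> j) - \<gamma>\<parallel>\<^sub>\<int>)"
  have fin: "finite ?P" by (intro finite_PiE) auto
  have nonneg: "?t r \<ge> 0" if "r \<in> ?P" for r
  proof -
    have "0 \<le> real_of_int (r j)" if "j \<in> {1..n}" for j
      using PiE_mem[OF \<open>r \<in> ?P\<close> that] by simp
    then have "(\<Prod>j=1..n. real_of_int (r j)) \<ge> 0" by (intro prod_nonneg) blast
    then have "(\<Prod>j=1..n. real_of_int (r j)) * \<parallel>(\<Sum>j=1..n. real_of_int (r j) * \<alpha> j) - \<gamma>\<parallel>\<^sub>\<int> \<ge> 0"
      by (intro mult_nonneg_nonneg dist_nearest_int_nonneg)
    moreover have "0 \<le> 1 / ereal x" if "0 \<le> x" for x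
      using that by (simp add: divide_ereal_def)
    ultimately show ?thesis by blast
  qed
  have "\<infinity> = ?t q" unfolding zero mult_zero_right one_div_zero_ereal ..
  also have "\<dots> = sum ?t {q}" by simp
  also have "\<dots> \<le> sum ?t ?P" using nonneg fin q by (intro sum_mono2) blast+
  finally show ?thesis unfolding reciprocal_sum_def by simp
qed

theorem theorem1p10:
  fixes n :: nat and \<alpha> :: "nat \<Rightarrow> real"
  assumes "n \<ge> 1"
    and "\<alpha> 1 \<notin> \<rat>"
    and "\<not> liouville_number (\<alpha> 1)"
  shows "\<exists>C::real. C > 0 \<and> (\<exists>T\<^sub>0::real. \<forall>(T::nat \<Rightarrow> int) (\<gamma>::real).
           (\<forall>i\<in>{1..n}. T i > 0) \<longrightarrow> real_of_int (T 1) > T\<^sub>0 \<longrightarrow>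
           reciprocal_sum n \<alpha> T \<gamma> \<ge>
             ereal (C * ln (real_of_int (T 1)) * (\<Prod>i=1..n. ln (real_of_int (T i)))))"
proof -
  obtain c :: real and K :: nat where c: "c > 0" and
    one_dim: "\<And>T \<gamma>. \<lbrakk>T \<ge> K; \<And>q. 0 < q \<Longrightarrow> q \<le> T \<Longrightarrow> \<parallel>real q * \<alpha> 1 - \<gamma>\<parallel>\<^sub>\<int> \<noteq> 0\<rbrakk>
       \<Longrightarrow> c * (ln (real T))\<^sup>2 \<le> (\<Sum>q=1..T. 1 / (real q * \<parallel>real q * \<alpha> 1 - \<gamma>\<parallel>\<^sub>\<int>))"
    using weighted_sum_lower_bound[OF assms(2,3)] by blast
  have ins: "{1..n} = insert 1 {2..n}" using assms(1) by auto
  show ?thesis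
  proof (rule exI[of _ c], rule conjI[OF c], rule exI[of _ "real K"], intro allI impI)
    fix T :: "nat \<Rightarrow> int" and \<gamma> :: real
    assume T: "\<forall>i\<in>{1..n}. T i > 0" and TK: "real K < real_of_int (T 1)"
    let ?P = "\<Pi>\<^sub>E j\<in>{1..n}. {1..T j}"
    let ?P' = "\<Pi>\<^sub>E j\<in>{2..n}. {1..T j}"
    let ?N = "\<lambda>q. \<parallel>(\<Sum>j=1..n. real_of_int (q j) * \<alpha> j) - \<gamma>\<parallel>\<^sub>\<int>"
    let ?t = "\<lambda>q. 1 / ((\<Prod>j=1..n. real_of_int (q j)) * ?N q)"
    show "ereal (c * ln (real_of_int (T 1)) * (\<Prod>i=1..n. ln (real_of_int (T i))))
        \<le> reciprocal_sum n \<alpha> T \<gamma>"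
    proof (cases "\<exists>q\<in>?P. ?N q = 0")
      case True
      then obtain q where "q \<in> ?P" "?N q = 0" by blast
      then have "reciprocal_sum n \<alpha> T \<gamma> = \<infinity>" by (rule reciprocal_sum_infinite)
      then show ?thesis by simp
    next
      case False
      then have nz: "\<And>q. q \<in> ?P \<Longrightarrow> ?N q \<noteq> 0" by blast
      \<comment> \<open>The translate of \<open>\<gamma>\<close> that remains once the coordinates from the second on are fixed as in \<open>g\<close>.\<close>
      define s where "s g = \<gamma> - (\<Sum>j\<in>{2..n}. real_of_int (g j) * \<alpha> j)" for g :: "nat \<Rightarrow> int"
      have T1: "T 1 > 0" using T assms(1) by auto
      have upd_P: "g(1 := y) \<in> ?P" if "y \<in> {1..T 1}" "g \<in> ?P'" for g y
        using that unfolding ins by (auto simp: PiE_iff extensional_def)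
      have upd_N: "?N (g(1 := y)) = \<parallel>real_of_int y * \<alpha> 1 - s g\<parallel>\<^sub>\<int>" for g y
        unfolding ins by (simp add: s_def algebra_simps)
      have upd_prod: "(\<Prod>j=1..n. real_of_int ((g(1 := y)) j))
          = real_of_int y * (\<Prod>j\<in>{2..n}. real_of_int (g j))" for g y
        unfolding ins by simp
      have inner: "c * (ln (real_of_int (T 1)))\<^sup>2
          \<le> (\<Sum>y\<in>{1..T 1}. 1 / (real_of_int y * \<parallel>real_of_int y * \<alpha> 1 - s g\<parallel>\<^sub>\<int>))"
        if g: "g \<in> ?P'" for g
      proof -
        have "c * (ln (real (nat (T 1))))\<^sup>2
            \<le> (\<Sum>q=1..nat (T 1). 1 / (real q * \<parallel>real q * \<alpha> 1 - s g\<parallel>\<^sub>\<int>))"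
        proof (rule one_dim)
          show "K \<le> nat (T 1)" using TK by linarith
          fix q :: nat assume "0 < q" "q \<le> nat (T 1)"
          then have "g(1 := int q) \<in> ?P" using g by (intro upd_P) auto
          from nz[OF this] show "\<parallel>real q * \<alpha> 1 - s g\<parallel>\<^sub>\<int> \<noteq> 0" unfolding upd_N by simp
        qed
        then show ?thesis using T1 by (simp add: sum_int_interval_eq_nat)
      qed
      have "c * ln (real_of_int (T 1)) * (\<Prod>i=1..n. ln (real_of_int (T i)))
          = c * (ln (real_of_int (T 1)))\<^sup>2 * (\<Prod>i\<in>{2..n}. ln (real_of_int (T i)))"
        unfolding ins by (simp add: power2_eq_square)
      also have "\<dots> \<le> c * (ln (real_of_int (T 1)))\<^sup>2
          * (\<Prod>i\<in>{2..n}. \<Sum>q\<in>{1..T i}. 1 / real_of_int q)"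
      proof (intro mult_left_mono prod_mono conjI)
        fix i assume "i \<in> {2..n}"
        then have "T i > 0" using T by auto
        then show "0 \<le> ln (real_of_int (T i))" by simp
        show "ln (real_of_int (T i)) \<le> (\<Sum>q\<in>{1..T i}. 1 / real_of_int q)"
          using \<open>T i > 0\<close> by (rule ln_le_sum_reciprocals_int)
      qed (use c in auto)
      also have "(\<Prod>i\<in>{2..n}. \<Sum>q\<in>{1..T i}. 1 / real_of_int q)
          = (\<Sum>g\<in>?P'. \<Prod>i\<in>{2..n}. 1 / real_of_int (g i))"
        by (rule prod_sum_PiE) auto
      also have "c * (ln (real_of_int (T 1)))\<^sup>2 * \<dots>
          = (\<Sum>g\<in>?P'. (\<Prod>i\<in>{2..n}. 1 / real_of_int (g i)) * (c * (ln (real_of_int (T 1)))\<^sup>2))"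
        by (simp add: sum_distrib_left mult.commute)
      also have "\<dots> \<le> (\<Sum>g\<in>?P'. (\<Prod>i\<in>{2..n}. 1 / real_of_int (g i)) *
          (\<Sum>y\<in>{1..T 1}. 1 / (real_of_int y * \<parallel>real_of_int y * \<alpha> 1 - s g\<parallel>\<^sub>\<int>)))"
      proof (intro sum_mono mult_left_mono inner prod_nonneg)
        fix g i assume "g \<in> ?P'" "i \<in> {2..n}"
        then have "g i \<in> {1..T i}" by (rule PiE_mem)
        then show "0 \<le> 1 / real_of_int (g i)" by simp
      qed
      also have "\<dots> = (\<Sum>g\<in>?P'. \<Sum>y\<in>{1..T 1}. ?t (g(1 := y)))"
        unfolding upd_N upd_prod sum_distrib_left
        by (intro sum.cong refl) (simp add: prod_dividef)
      also have "\<dots> = (\<Sum>y\<in>{1..T 1}. \<Sum>g\<in>?P'. ?t (g(1 := y)))" by (rule sum.swap)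
      also have "\<dots> = (\<Sum>(y, g)\<in>{1..T 1} \<times> ?P'. ?t (g(1 := y)))"
        by (rule sum.cartesian_product)
      also have "\<dots> = (\<Sum>q\<in>(\<lambda>(y, g). g(1 := y)) ` ({1..T 1} \<times> ?P'). ?t q)"
        by (subst sum.reindex[OF inj_combinator]) (auto simp: case_prod_unfold)
      also have "(\<lambda>(y, g). g(1 := y)) ` ({1..T 1} \<times> ?P') = ?P"
        unfolding ins PiE_insert_eq ..
      finally show ?thesis by (simp only: reciprocal_sum_finite_eq[OF nz] ereal_less_eq)
    qed
  qed
qed

end
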